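(* Let $G$ and $H$ be finite simple undirected graphs and $k=\min\{\chi(G),\chi(H)\}$. Then $$\chi_o^+(G\,\square\,H)\le k\,\chi_o^+(G)\,\chi_o^+(H).$$
   Context: An oriented graph is a digraph with no loops, no multiple arcs and no pair of opposite arcs; an orientation of an undirected graph gives each edge one of its two directions. A homomorphism between oriented graphs is a vertex map sending arcs to arcs. The upper oriented chromatic number $\chi_o^+(G)$ is the smallest order of an oriented graph $\vec T$ such that every orientation of $G$ admits a homomorphism to $\vec T$. $\chi$ is the chromatic number. The Cartesian product $G\,\square\,H$ has vertex set $V(G)\times V(H)$, and $\{[u,v],[u',v']\}$ is an edge iff either $u=u'$ and $\{v,v'\}\in E(H)$, or $v=v'$ and $\{u,u'\}\in E(G)$. *)

theory Defs
  imports "Graph_Theory.Pair_Digraph"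
begin

text \<open>
  Finite simple undirected graphs are the \<^locale>\<open>pair_graph\<close>s of the library: an edge $\{u,v\}$ is
  represented by the two arcs $(u,v)$ and $(v,u)$. The null graph is allowed.
\<close>

definition cartesian_product ::
    "'a pair_pre_digraph \<Rightarrow> 'b pair_pre_digraph \<Rightarrow> ('a \<times> 'b) pair_pre_digraph"
    (infixr \<open>\<box>\<close> 80) where
  "G \<box> H = \<lparr> pverts = pverts G \<times> pverts H,
    parcs = {((u, v), (u', v')) | u v u' v'.
      u \<in> pverts G \<and> u = u' \<and> (v, v') \<in> parcs H \<or>
      v \<in> pverts H \<and> v = v' \<and> (u, u') \<in> parcs G} \<rparr>"

definition proper_coloring :: "'a pair_pre_digraph \<Rightarrow> nat \<Rightarrow> ('a \<Rightarrow> nat) \<Rightarrow> bool" where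
  "proper_coloring G n c \<longleftrightarrow>
    c \<in> pverts G \<rightarrow> {..<n} \<and> (\<forall>(u, v) \<in> parcs G. c u \<noteq> c v)"

definition chromatic_number :: "'a pair_pre_digraph \<Rightarrow> nat" (\<open>\<chi>\<close>) where
  "\<chi> G = (LEAST n. \<exists>c. proper_coloring G n c)"

text \<open>Loops and parallel arcs are already excluded by \<^locale>\<open>pair_digraph\<close>, which also requires
  finiteness.\<close>

definition oriented_graph :: "'a pair_pre_digraph \<Rightarrow> bool" where
  "oriented_graph T \<longleftrightarrow> pair_digraph T \<and> (\<forall>u v. (u, v) \<in> parcs T \<longrightarrow> (v, u) \<notin> parcs T)"

definition orientation_of :: "'a pair_pre_digraph \<Rightarrow> 'a pair_pre_digraph \<Rightarrow> bool" where
  "orientation_of D G \<longleftrightarrow>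
    pverts D = pverts G \<and> parcs D \<subseteq> parcs G \<and>
    (\<forall>(u, v) \<in> parcs G. ((u, v) \<in> parcs D) \<noteq> ((v, u) \<in> parcs D))"

definition digraph_hom ::
    "('a \<Rightarrow> 'b) \<Rightarrow> 'a pair_pre_digraph \<Rightarrow> 'b pair_pre_digraph \<Rightarrow> bool" where
  "digraph_hom h D T \<longleftrightarrow>
    h \<in> pverts D \<rightarrow> pverts T \<and> (\<forall>(u, v) \<in> parcs D. (h u, h v) \<in> parcs T)"

definition universal_target :: "'a pair_pre_digraph \<Rightarrow> 'b pair_pre_digraph \<Rightarrow> bool" where
  "universal_target G T \<longleftrightarrow>
    oriented_graph T \<and> (\<forall>D. orientation_of D G \<longrightarrow> (\<exists>h. digraph_hom h D T))"

text \<open>Since targets are finite, it is no restriction to take their vertices to be natural numbers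
  (see \<open>upper_oriented_chromatic_number_le\<close> below).\<close>

definition upper_oriented_chromatic_number :: "'a pair_pre_digraph \<Rightarrow> nat" (\<open>\<chi>\<^sub>o\<^sup>+\<close>) where
  "\<chi>\<^sub>o\<^sup>+ G = (LEAST n. \<exists>T :: nat pair_pre_digraph. universal_target G T \<and> card (pverts T) = n)"

lemma universal_target_nat:
  fixes T :: "'b pair_pre_digraph"
  assumes "universal_target G T"
  shows "\<exists>T' :: nat pair_pre_digraph. universal_target G T' \<and> card (pverts T') = card (pverts T)"
proof -
  have T: "pair_digraph T" "\<And>u v. (u, v) \<in> parcs T \<Longrightarrow> (v, u) \<notin> parcs T"
    using assms by (auto simp: universal_target_def oriented_graph_def)
  interpret pair_digraph T by (fact T)
  obtain f :: "'b \<Rightarrow> nat" where f: "inj_on f (pverts T)"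
    using finite_imp_inj_to_nat_seg[OF pair_finite_verts] by blast
  define T' where "T' = \<lparr> pverts = f ` pverts T, parcs = (\<lambda>(u, v). (f u, f v)) ` parcs T \<rparr>"
  have "pair_digraph T'"
  proof
    fix e assume "e \<in> parcs T'"
    then obtain u v where e: "e = (f u, f v)" and uv: "(u, v) \<in> parcs T"
      by (auto simp: T'_def)
    show "fst e \<in> pverts T'" "snd e \<in> pverts T'"
      using in_arcsD1[OF uv] in_arcsD2[OF uv] by (auto simp: e T'_def)
    show "fst e \<noteq> snd e"
      using pair_no_loops[OF uv] in_arcsD1[OF uv] in_arcsD2[OF uv] f by (auto simp: e inj_on_def)
  qed (auto simp: T'_def pair_finite_verts pair_finite_arcs)
  moreover have "(y, x) \<notin> parcs T'" if "(x, y) \<in> parcs T'" for x y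
  proof
    assume "(y, x) \<in> parcs T'"
    with that obtain u v u' v' where
      "(u, v) \<in> parcs T" "(u', v') \<in> parcs T" "f u = f v'" "f v = f u'"
      by (auto simp: T'_def)
    moreover from this have "u = v'" "v = u'"
      using f by (meson in_arcsD1 in_arcsD2 inj_onD)+
    ultimately show False using T(2) by blast
  qed
  moreover have "\<exists>h. digraph_hom h D T'" if D: "orientation_of D G" for D
  proof -
    obtain h where "digraph_hom h D T" using assms D by (auto simp: universal_target_def)
    then have "digraph_hom (f \<circ> h) D T'" by (force simp: digraph_hom_def T'_def)
    then show ?thesis by blast
  qed
  ultimately have "universal_target G T'"
    by (auto simp: universal_target_def oriented_graph_def)
  moreover have "card (pverts T') = card (pverts T)"
    by (simp add: T'_def card_image f)
  ultimately show ?thesis by blast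
qed

lemma upper_oriented_chromatic_number_le:
  fixes T :: "'b pair_pre_digraph"
  assumes "universal_target G T"
  shows "\<chi>\<^sub>o\<^sup>+ G \<le> card (pverts T)"
  unfolding upper_oriented_chromatic_number_def
  by (rule Least_le) (rule universal_target_nat[OF assms])

text \<open>The disjoint union of all orientations of a graph is a target, so the minimum is attained.\<close>

lemma universal_target_exists:
  fixes G :: "'a pair_pre_digraph"
  assumes "pair_graph G"
  shows "\<exists>T :: ('a rel \<times> 'a) pair_pre_digraph. universal_target G T"
proof -
  interpret pair_graph G by (fact assms)
  define R where "R = {A. A \<subseteq> parcs G \<and> (\<forall>u v. (u, v) \<in> A \<longrightarrow> (v, u) \<notin> A)}"
  define T where "T = \<lparr> pverts = R \<times> pverts G,
    parcs = {((A, u), (A, v)) | A u v. A \<in> R \<and> (u, v) \<in> A} \<rparr>"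
  have fin: "finite R"
    unfolding R_def by (rule finite_subset[OF _ finite_Pow_iff[THEN iffD2, OF pair_finite_arcs]]) auto
  have sub: "parcs T \<subseteq> pverts T \<times> pverts T"
    by (auto simp: T_def R_def dest: in_arcsD1 in_arcsD2)
  have "finite (pverts T)" by (simp add: T_def fin pair_finite_verts)
  then have "pair_digraph T"
  proof unfold_locales
    fix e assume e: "e \<in> parcs T"
    show "fst e \<in> pverts T" "snd e \<in> pverts T" using sub e by auto
    show "fst e \<noteq> snd e" using e by (fastforce simp: T_def R_def)
  next
    assume "finite (pverts T)" then show "finite (parcs T)"
      using sub by (meson finite_SigmaI finite_subset)
  qed
  moreover have "(y, x) \<notin> parcs T" if "(x, y) \<in> parcs T" for x y
    using that by (auto simp: T_def R_def)
  moreover have "\<exists>h. digraph_hom h D T" if D: "orientation_of D G" for D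
  proof -
    have "parcs D \<in> R" using D by (force simp: R_def orientation_of_def)
    then have "digraph_hom (Pair (parcs D)) D T"
      using D by (auto simp: digraph_hom_def T_def orientation_of_def)
    then show ?thesis by blast
  qed
  ultimately show ?thesis
    unfolding universal_target_def oriented_graph_def by blast
qed

lemma upper_oriented_chromatic_number_attained:
  assumes "pair_graph G"
  shows "\<exists>T :: nat pair_pre_digraph. universal_target G T \<and> card (pverts T) = \<chi>\<^sub>o\<^sup>+ G"
  unfolding upper_oriented_chromatic_number_def
  by (rule LeastI_ex) (use universal_target_exists[OF assms] universal_target_nat in blast)

end

theory Submission
  imports Defs
begin

text \<open>
  Colour $G$ properly with $\chi(G)$ colours. Given an orientation of $G \mathbin{\square} H$, map every
  $G$-layer to an optimal target for $G$ and every $H$-layer to an optimal target for $H$, each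
  independently of the other layers. Send $[u,v]$ to the triple formed by its two images and the colour
  of $u$. The colour changes along an arc of a $G$-layer and is constant along an arc of an $H$-layer, so
  an arc between triples may be prescribed by the first target if the colours differ and by the second if
  they agree. No two such arcs are opposite. The other factor can be coloured instead because
  the product is commutative.
\<close>

text \<open>Arcs of \<open>X\<close> and \<open>Y\<close> correspond both ways under \<phi>, so
  exactly one direction of each edge of \<open>X\<close> survives in the pullback and nothing
  outside \<open>X\<close> enters.\<close>

lemma orientation_of_pullback:
  assumes "orientation_of D Y"
    and "\<And>u v. (\<phi> u, \<phi> v) \<in> parcs Y \<longleftrightarrow> (u, v) \<in> parcs X"
  shows "orientation_of \<lparr> pverts = pverts X, parcs = {(u, v). (\<phi> u, \<phi> v) \<in> parcs D} \<rparr> X"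
proof -
  have "((\<phi> u, \<phi> v) \<in> parcs D) \<noteq> ((\<phi> v, \<phi> u) \<in> parcs D)" if "(u, v) \<in> parcs X" for u v
    using assms(1) that[folded assms(2)] unfolding orientation_of_def by blast
  moreover have "(u, v) \<in> parcs X" if "(\<phi> u, \<phi> v) \<in> parcs D" for u v
    using assms that unfolding orientation_of_def by blast
  ultimately show ?thesis by (auto simp: orientation_of_def)
qed

text \<open>Serves two embeddings \<phi>: the inclusion of a factor as a layer of the product, and
  the swap of coordinates.\<close>

lemma universal_target_pullback:
  assumes "universal_target Y T" and "orientation_of D X"
    and "\<And>u v. (\<phi> u, \<phi> v) \<in> parcs X \<longleftrightarrow> (u, v) \<in> parcs Y"
  shows "\<exists>h. h \<in> pverts Y \<rightarrow> pverts T \<and>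
    (\<forall>u v. (\<phi> u, \<phi> v) \<in> parcs D \<longrightarrow> (h u, h v) \<in> parcs T)"
proof -
  obtain h where
    "digraph_hom h \<lparr> pverts = pverts Y, parcs = {(u, v). (\<phi> u, \<phi> v) \<in> parcs D} \<rparr> T"
    using orientation_of_pullback[OF assms(2,3)] assms(1) unfolding universal_target_def by blast
  then show ?thesis by (auto simp: digraph_hom_def)
qed

lemma parcs_cartesian_product:
  "((u, v), (u', v')) \<in> parcs (G \<box> H) \<longleftrightarrow>
    u \<in> pverts G \<and> u = u' \<and> (v, v') \<in> parcs H \<or> v \<in> pverts H \<and> v = v' \<and> (u, u') \<in> parcs G"
  by (simp add: cartesian_product_def)

lemma pverts_cartesian_product [simp]: "pverts (G \<box> H) = pverts G \<times> pverts H"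
  by (simp add: cartesian_product_def)

lemma universal_target_cartesian_product_commute:
  assumes "universal_target (G \<box> H) T"
  shows "universal_target (H \<box> G) T"
  unfolding universal_target_def
proof (intro conjI allI impI)
  show "oriented_graph T" using assms by (simp add: universal_target_def)
next
  fix D assume D: "orientation_of D (H \<box> G)"
  have "(prod.swap p, prod.swap q) \<in> parcs (H \<box> G) \<longleftrightarrow> (p, q) \<in> parcs (G \<box> H)" for p q
    by (cases p; cases q) (auto simp: parcs_cartesian_product)
  from universal_target_pullback[OF assms D this] obtain h where
    h: "h \<in> pverts (G \<box> H) \<rightarrow> pverts T"
      "\<And>p q. (prod.swap p, prod.swap q) \<in> parcs D \<Longrightarrow> (h p, h q) \<in> parcs T"
    by blast
  \<comment> \<open>Swapping is an involution, so every arc of \<open>D\<close> is the swap of a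
    pair to which \<open>h\<close> applies.\<close>
  have "digraph_hom (h \<circ> prod.swap) D T"
    using h D by (auto simp: digraph_hom_def orientation_of_def)
  then show "\<exists>h. digraph_hom h D T" by blast
qed

text \<open>Finiteness lets all vertices receive different colours, so the minimum ranges over a
  nonempty set.\<close>

lemma proper_coloring_chromatic_number:
  assumes "pair_graph G"
  shows "\<exists>c. proper_coloring G (\<chi> G) c"
proof -
  interpret pair_graph G by (fact assms)
  obtain f :: "'a \<Rightarrow> nat" and n where f: "f ` pverts G = {i. i < n}" "inj_on f (pverts G)"
    using finite_imp_inj_to_nat_seg[OF pair_finite_verts] by blast
  have "proper_coloring G n f"
    unfolding proper_coloring_def
  proof (intro conjI ballI)
    show "f \<in> pverts G \<rightarrow> {..<n}" using f(1) by auto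
  next
    fix e assume "e \<in> parcs G"
    then show "case e of (u, v) \<Rightarrow> f u \<noteq> f v"
      using inj_onD[OF f(2)] pair_no_loops[of e] in_arcsD1 in_arcsD2 by (cases e) fastforce
  qed
  then show ?thesis
    unfolding chromatic_number_def by (intro LeastI_ex[of "\<lambda>n. \<exists>c. proper_coloring G n c"]) iprover
qed

text \<open>An arc constrains only one of the pairs \<open>x, x'\<close> and \<open>y, y'\<close>.
  The other is arbitrary, because maps chosen on different layers are unrelated; its membership in
  the target is therefore demanded explicitly.\<close>

definition colored_target ::
    "nat \<Rightarrow> 'c pair_pre_digraph \<Rightarrow> 'd pair_pre_digraph \<Rightarrow> (nat \<times> 'c \<times> 'd) pair_pre_digraph" where
  "colored_target n S T = \<lparr> pverts = {..<n} \<times> pverts S \<times> pverts T,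
    parcs = {((i, x, y), (j, x', y')) | i x y j x' y'.
      {i, j} \<subseteq> {..<n} \<and> {x, x'} \<subseteq> pverts S \<and> {y, y'} \<subseteq> pverts T \<and>
      (if i = j then (y, y') \<in> parcs T else (x, x') \<in> parcs S)} \<rparr>"

text \<open>The test \<open>i = j\<close> is symmetric, so an arc and its reverse would both be read
  in the same target, which is oriented.\<close>

lemma oriented_graph_colored_target:
  assumes "oriented_graph S" and "oriented_graph T"
  shows "oriented_graph (colored_target n S T)"
proof -
  interpret S: pair_digraph S using assms(1) by (simp add: oriented_graph_def)
  interpret T: pair_digraph T using assms(2) by (simp add: oriented_graph_def)
  let ?U = "colored_target n S T"
  have sub: "parcs ?U \<subseteq> pverts ?U \<times> pverts ?U"
    by (auto simp: colored_target_def)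
  have fin: "finite (pverts ?U)"
    by (simp add: colored_target_def S.pair_finite_verts T.pair_finite_verts)
  have "pair_digraph ?U"
  proof
    fix e assume e: "e \<in> parcs ?U"
    show "fst e \<in> pverts ?U" "snd e \<in> pverts ?U" using sub e by auto
    \<comment> \<open>A loop has equal colours, so it would yield a loop of
      \<open>T\<close>.\<close>
    show "fst e \<noteq> snd e" using e T.pair_no_loops by (fastforce simp: colored_target_def)
  next
    show "finite (pverts ?U)" by (fact fin)
    show "finite (parcs ?U)" using fin sub by (meson finite_SigmaI finite_subset)
  qed
  moreover have "(q, p) \<notin> parcs ?U" if "(p, q) \<in> parcs ?U" for p q
    using that assms by (auto simp: colored_target_def oriented_graph_def split: if_splits)
  ultimately show ?thesis by (simp add: oriented_graph_def)
qed

lemma universal_target_colored_target: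
  assumes "pair_graph G" and "pair_graph H" and c: "proper_coloring G n c"
    and S: "universal_target G S" and T: "universal_target H T"
  shows "universal_target (G \<box> H) (colored_target n S T)"
  unfolding universal_target_def
proof (intro conjI allI impI)
  show "oriented_graph (colored_target n S T)"
    using S T by (simp add: universal_target_def oriented_graph_colored_target)
next
  interpret G: pair_graph G by (fact assms(1))
  interpret H: pair_graph H by (fact assms(2))
  fix D assume D: "orientation_of D (G \<box> H)"
  have "\<exists>h. h \<in> pverts G \<rightarrow> pverts S \<and>
      (\<forall>u u'. ((u, v), (u', v)) \<in> parcs D \<longrightarrow> (h u, h u') \<in> parcs S)" if "v \<in> pverts H" for v
    \<comment> \<open>Without a loop at \<open>v\<close>, an arc inside this layer can only come
      from \<open>G\<close>.\<close>
    using that H.pair_no_loops[of "(v, v)"]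
    by (intro universal_target_pullback[OF S D]) (auto simp: parcs_cartesian_product)
  then obtain f where f: "\<And>v. v \<in> pverts H \<Longrightarrow> f v \<in> pverts G \<rightarrow> pverts S"
      "\<And>u v u'. v \<in> pverts H \<Longrightarrow> ((u, v), (u', v)) \<in> parcs D \<Longrightarrow> (f v u, f v u') \<in> parcs S"
    by metis
  have "\<exists>h. h \<in> pverts H \<rightarrow> pverts T \<and>
      (\<forall>v v'. ((u, v), (u, v')) \<in> parcs D \<longrightarrow> (h v, h v') \<in> parcs T)" if "u \<in> pverts G" for u
    using that G.pair_no_loops[of "(u, u)"]
    by (intro universal_target_pullback[OF T D]) (auto simp: parcs_cartesian_product)
  then obtain g where g: "\<And>u. u \<in> pverts G \<Longrightarrow> g u \<in> pverts H \<rightarrow> pverts T"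
      "\<And>u v v'. u \<in> pverts G \<Longrightarrow> ((u, v), (u, v')) \<in> parcs D \<Longrightarrow> (g u v, g u v') \<in> parcs T"
    by metis
  define h where "h = (\<lambda>(u, v). (c u, f v u, g u v))"
  have c_less: "c u < n" if "u \<in> pverts G" for u
    using c that by (auto simp: proper_coloring_def)
  have h_in: "h \<in> pverts D \<rightarrow> pverts (colored_target n S T)"
    using D f(1) g(1) c_less by (auto simp: h_def colored_target_def orientation_of_def Pi_iff)
  have "(h (u, v), h (u', v')) \<in> parcs (colored_target n S T)"
    if a: "((u, v), (u', v')) \<in> parcs D" for u v u' v'
  proof -
    have "((u, v), (u', v')) \<in> parcs (G \<box> H)" using a D by (auto simp: orientation_of_def)
    then consider "u \<in> pverts G" "u = u'" "(v, v') \<in> parcs H"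
      | "v \<in> pverts H" "v = v'" "(u, u') \<in> parcs G"
      by (auto simp: parcs_cartesian_product)
    then show ?thesis
    proof cases
      case 1
      \<comment> \<open>The colours agree, so \<open>g u\<close> supplies the arc in
        \<open>T\<close>. The values \<open>f v u\<close> and \<open>f v' u\<close> come from
        different layers and need only be vertices of \<open>S\<close>.\<close>
      then have "v \<in> pverts H" "v' \<in> pverts H" by (auto dest: H.in_arcsD1 H.in_arcsD2)
      then show ?thesis
        using 1 a f(1) g c_less by (auto simp: h_def colored_target_def Pi_iff)
    next
      case 2
      then have "u \<in> pverts G" "u' \<in> pverts G" by (auto dest: G.in_arcsD1 G.in_arcsD2)
      \<comment> \<open>Properness of \<open>c\<close> selects the branch governed by
        \<open>S\<close>, where \<open>f v\<close> supplies the arc.\<close>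
      moreover have "c u \<noteq> c u'" using c 2 by (auto simp: proper_coloring_def)
      ultimately show ?thesis
        using 2 a f g(1) c_less by (auto simp: h_def colored_target_def Pi_iff)
    qed
  qed
  with h_in have "digraph_hom h D (colored_target n S T)"
    by (auto simp: digraph_hom_def)
  then show "\<exists>h. digraph_hom h D (colored_target n S T)" by blast
qed

lemma universal_target_cartesian_product:
  fixes G :: "'a pair_pre_digraph" and H :: "'b pair_pre_digraph"
  assumes "pair_graph G" and "pair_graph H"
  shows "\<exists>U :: (nat \<times> nat \<times> nat) pair_pre_digraph.
    universal_target (G \<box> H) U \<and> card (pverts U) = \<chi> G * (\<chi>\<^sub>o\<^sup>+ G * \<chi>\<^sub>o\<^sup>+ H)"
proof -
  obtain c where c: "proper_coloring G (\<chi> G) c"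
    using proper_coloring_chromatic_number[OF assms(1)] ..
  obtain S :: "nat pair_pre_digraph" where
    S: "universal_target G S" "card (pverts S) = \<chi>\<^sub>o\<^sup>+ G"
    using upper_oriented_chromatic_number_attained[OF assms(1)] by blast
  obtain T :: "nat pair_pre_digraph" where
    T: "universal_target H T" "card (pverts T) = \<chi>\<^sub>o\<^sup>+ H"
    using upper_oriented_chromatic_number_attained[OF assms(2)] by blast
  have "card (pverts (colored_target (\<chi> G) S T)) = \<chi> G * (\<chi>\<^sub>o\<^sup>+ G * \<chi>\<^sub>o\<^sup>+ H)"
    by (simp add: colored_target_def card_cartesian_product S(2) T(2))
  with universal_target_colored_target[OF assms c S(1) T(1)] show ?thesis by blast
qed

theorem theorem12:
  fixes G :: "'a pair_pre_digraph" and H :: "'b pair_pre_digraph" and k :: nat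
  assumes "pair_graph G" and "pair_graph H"
    and "k = min (\<chi> G) (\<chi> H)"
  shows "\<chi>\<^sub>o\<^sup>+ (G \<box> H) \<le> k * \<chi>\<^sub>o\<^sup>+ G * \<chi>\<^sub>o\<^sup>+ H"
proof -
  have "\<chi>\<^sub>o\<^sup>+ (G \<box> H) \<le> \<chi> G * (\<chi>\<^sub>o\<^sup>+ G * \<chi>\<^sub>o\<^sup>+ H)"
    using universal_target_cartesian_product[OF assms(1,2)] upper_oriented_chromatic_number_le
    by metis
  \<comment> \<open>Here \<open>H\<close> is coloured: the target built for
    \<open>H \<box> G\<close> also serves \<open>G \<box> H\<close>.\<close>
  moreover have "\<chi>\<^sub>o\<^sup>+ (G \<box> H) \<le> \<chi> H * (\<chi>\<^sub>o\<^sup>+ H * \<chi>\<^sub>o\<^sup>+ G)"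
    using universal_target_cartesian_product[OF assms(2,1)]
      universal_target_cartesian_product_commute upper_oriented_chromatic_number_le
    by metis
  ultimately show ?thesis by (simp add: assms(3) min_def ac_simps)
qed

end
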